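(* Let $p>3$ be a prime integer such that $p\equiv 2 \pmod 3$. The equation $p\cdot 3^x+p^y=z^2$ admits a solution $(x,y,z)\in\mathbb{N}^3$ if and only if $p-2$ is a non-trivial power of $3$. In the affirmative case, the unique solution in $\mathbb{N}^3$ is $(x,y,z)=(\log_3(p-2),\,0,\,p-1)$.
   Context: $\mathbb{N}=\{0,1,2,3,\ldots\}$ denotes the set of non-negative integers, and $\mathbb{N}^{*}=\mathbb{N}\setminus\{0\}$. An integer $h$ is called a non-trivial power of $3$ if $h=3^k$ for some $k\in\mathbb{N}^{*}$. *)

theory Defs
  imports Complex_Main "HOL-Number_Theory.Cong" "HOL-Computational_Algebra.Primes"
begin

definition nontrivial_power_of_3 :: "int \<Rightarrow> bool" where
  "nontrivial_power_of_3 h \<longleftrightarrow> (\<exists>k::nat. k \<noteq> 0 \<and> h = 3 ^ k)"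

definition is_solution :: "int \<Rightarrow> nat \<times> nat \<times> nat \<Rightarrow> bool" where
  "is_solution p = (\<lambda>(x, y, z). p * 3 ^ x + p ^ y = (int z)\<^sup>2)"

end

theory Submission
  imports Defs
begin

text \<open>
  If $y \ge 1$ then $p$ divides $z$, so $p^2$ divides $p \cdot 3^x + p^y$; this excludes $y \ge 2$,
  while $y = 1$ is impossible modulo $3$ when $x \ge 1$ and modulo $p^2$ when $x = 0$. If $y = 0$
  then $p \cdot 3^x = (z - 1)(z + 1)$, where $3$ divides at most one factor, so the factors are
  $1, p \cdot 3^x$ or $p, 3^x$ in some order; only $z + 1 = p$, $z - 1 = 3^x$ is compatible with
  $p > 3$ and $p \equiv 2 \pmod 3$.
\<close>

text \<open>If \<open>q\<close> does not divide \<open>a\<close>, then \<open>a\<close> is coprime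
  to \<open>q ^ n\<close>, and a divisor of \<open>q ^ n\<close> coprime to it is a unit. With
  \<open>q = 3\<close> this controls the cofactors of \<open>3 ^ x\<close> below.\<close>

lemma dvd_prime_power_cases:
  fixes a q :: int
  assumes "prime q" "a dvd q ^ n" "a > 0"
  shows "a = 1 \<or> q dvd a"
proof (rule disjCI)
  assume "\<not> q dvd a"
  then have "coprime a (q ^ n)"
    using prime_imp_coprime[OF assms(1)] by (simp add: coprime_commute)
  then have "is_unit a"
    using assms(2) coprime_absorb_left by blast
  then show "a = 1"
    using assms(3) by simp
qed

lemma solution_y_eq_0:
  fixes p z :: int
  assumes p: "prime p" "p > 3" "[p = 2] (mod 3)"
    and eq: "p * 3 ^ x + p ^ y = z\<^sup>2"
  shows "y = 0"
proof (rule ccontr)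
  assume "y \<noteq> 0"
  then have "p dvd z\<^sup>2"
    by (simp flip: eq)
  then have "p dvd z"
    using p(1) prime_dvd_power by blast
  then have p2: "p\<^sup>2 dvd p * 3 ^ x + p ^ y"
    by (simp add: eq)
  have "\<not> p dvd 3 ^ x"
  proof
    assume "p dvd 3 ^ x"
    then have "p dvd 3"
      using p(1) prime_dvd_power by blast
    then show False
      using p(2) zdvd_imp_le by force
  qed
  \<comment> \<open>Cancelling one factor \<open>p\<close> would leave
    \<open>p dvd 3 ^ x\<close>.\<close>
  then have "\<not> p\<^sup>2 dvd p * 3 ^ x"
    using p(2) by (simp add: power2_eq_square)
  then have "\<not> p\<^sup>2 dvd p ^ y"
    using p2 dvd_add_left_iff by blast
  then have "\<not> 2 \<le> y"
    using le_imp_power_dvd by blast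
  with \<open>y \<noteq> 0\<close> have y: "y = 1"
    by simp
  show False
  proof (cases x)
    case 0
    \<comment> \<open>Here the sum is \<open>2 * p\<close>, and \<open>p\<close> cancels from its
      divisibility by the square of \<open>p\<close>.\<close>
    have "p dvd 2"
      using p2 p(2) by (simp add: 0 y power2_eq_square flip: mult_2_right)
    then show False
      using p(2) zdvd_imp_le by force
  next
    case (Suc n)
    have "z\<^sup>2 mod 3 = (p + 3 * (p * 3 ^ n)) mod 3"
      using eq by (simp add: Suc y algebra_simps)
    also have "\<dots> = 2"
      using p(3) by (simp add: cong_def)
    finally have "(z mod 3)\<^sup>2 mod 3 = 2"
      by (simp add: power_mod)
    \<comment> \<open>The squares of these residues are only 0 and 1 modulo 3.\<close>
    moreover have "z mod 3 = 0 \<or> z mod 3 = 1 \<or> z mod 3 = 2"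
      by presburger
    ultimately show False
      by auto
  qed
qed

text \<open>Keeping \<open>3 ^ x\<close> in place of a logarithm lets existence and uniqueness be
  read off over the integers.\<close>

lemma solution_iff:
  fixes p :: int
  assumes p: "prime p" "p > 3" "[p = 2] (mod 3)"
  shows "is_solution p (x, y, z) \<longleftrightarrow> p - 2 = 3 ^ x \<and> y = 0 \<and> int z = p - 1"
proof
  assume "p - 2 = 3 ^ x \<and> y = 0 \<and> int z = p - 1"
  then have *: "3 ^ x = p - 2" "y = 0" "int z = p - 1"
    by linarith+
  show "is_solution p (x, y, z)"
    unfolding is_solution_def prod.case * by (simp add: power2_eq_square algebra_simps)
next
  define w where "w = int z"
  assume "is_solution p (x, y, z)"
  then have eq: "p * 3 ^ x + p ^ y = w\<^sup>2"
    by (simp add: is_solution_def w_def)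
  then have y: "y = 0"
    using solution_y_eq_0 p by blast
  have prod: "p * 3 ^ x = (w - 1) * (w + 1)"
    using eq by (simp add: y power2_eq_square algebra_simps)
  \<comment> \<open>Positivity rules out \<open>w = 0\<close> and \<open>w = 1\<close>, so both
    factors \<open>w - 1\<close> and \<open>w + 1\<close> are positive.\<close>
  have "0 < p * 3 ^ x"
    using p(2) by simp
  then have "0 < (w - 1) * (w + 1)"
    by (simp only: prod)
  moreover have "w \<ge> 0"
    by (simp add: w_def)
  ultimately have w: "w > 1"
    by (simp add: zero_less_mult_iff)
  have prime3: "prime (3::int)"
    by simp
  have "p dvd (w - 1) * (w + 1)"
    by (simp flip: prod)
  then consider "p dvd w + 1" | "p dvd w - 1"
    using p(1) prime_dvd_mult_iff by blast
  then have "w = p - 1 \<and> 3 ^ x = p - 2"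
  proof cases
    case 1
    then obtain c where c: "w + 1 = p * c" ..
    \<comment> \<open>After cancelling \<open>p\<close>, the numbers \<open>w - 1\<close> and
      \<open>c\<close> are complementary divisors of \<open>3 ^ x\<close>: each is 1 or a multiple
      of 3.\<close>
    have pow: "3 ^ x = (w - 1) * c"
      using prod p(2) by (simp add: c)
    have "c > 0"
      using c w p(2) zero_less_mult_pos[of p c] by linarith
    have "w - 1 = 1 \<or> 3 dvd w - 1"
      using w pow by (intro dvd_prime_power_cases[OF prime3, of _ x]) auto
    moreover have "c = 1 \<or> 3 dvd c"
      using \<open>c > 0\<close> pow by (intro dvd_prime_power_cases[OF prime3, of _ x]) auto
    moreover have "w - 1 \<noteq> 1"
    proof
      assume "w - 1 = 1"
      then have "p dvd 3"
        using c by (metis add.commute diff_eq_eq dvd_triv_left one_add_one one_plus_numeral semiring_norm(3))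
      then show False
        using p(2) zdvd_imp_le by force
    qed
    \<comment> \<open>A common factor 3 would divide both \<open>w - 1\<close> and
      \<open>w + 1\<close>, hence their difference 2.\<close>
    moreover have "\<not> (3 dvd w - 1 \<and> 3 dvd c)"
    proof
      assume "3 dvd w - 1 \<and> 3 dvd c"
      then have "3 dvd w - 1" "3 dvd w + 1"
        by (auto simp: c)
      then show False
        by presburger
    qed
    ultimately have "c = 1"
      by blast
    then show ?thesis
      using c pow by simp
  next
    case 2
    \<comment> \<open>This case is contradictory: \<open>w + 1\<close> absorbs the factor 3, forcing
      \<open>c = 1\<close> and \<open>p = w - 1\<close>, which is then 1 modulo 3 instead of
      2.\<close>
    then obtain c where c: "w - 1 = p * c" ..
    have pow: "3 ^ x = c * (w + 1)"
      using prod p(2) by (simp add: c)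
    have "c > 0"
      using c w p(2) zero_less_mult_pos[of p c] by linarith
    have "w + 1 = 1 \<or> 3 dvd w + 1"
      using w pow by (intro dvd_prime_power_cases[OF prime3, of _ x]) auto
    then have dvd: "3 dvd w + 1"
      using w by simp
    have "c = 1 \<or> 3 dvd c"
      using \<open>c > 0\<close> pow by (intro dvd_prime_power_cases[OF prime3, of _ x]) auto
    moreover have "\<not> 3 dvd c"
    proof
      assume "3 dvd c"
      then have "3 dvd w - 1"
        by (simp add: c)
      then show False
        using dvd by presburger
    qed
    ultimately have "p = w - 1"
      using c by simp
    then have "(w - 1) mod 3 = 2"
      using p(3) by (simp add: cong_def)
    then show ?thesis
      using dvd by presburger
  qed
  then show "p - 2 = 3 ^ x \<and> y = 0 \<and> int z = p - 1"
    by (simp add: y w_def)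
qed

theorem theorem0p13:
  fixes p :: int
  assumes "prime p" and "p > 3" and "[p = 2] (mod 3)"
  shows "((\<exists>s. is_solution p s) \<longleftrightarrow> nontrivial_power_of_3 (p - 2)) \<and>
         (nontrivial_power_of_3 (p - 2) \<longrightarrow>
           (\<exists>!s. is_solution p s) \<and>
           (\<forall>x y z. is_solution p (x, y, z) \<longleftrightarrow>
              real x = log 3 (real_of_int (p - 2)) \<and> y = 0 \<and> int z = p - 1))"
proof -
  note sol = solution_iff[OF assms]
  have power: "nontrivial_power_of_3 (p - 2)" if "is_solution p s" for s
  proof -
    obtain x y z where s: "s = (x, y, z)"
      by (cases s)
    have x: "p - 2 = 3 ^ x"
      using that by (simp add: s sol)
    \<comment> \<open>Otherwise \<open>p = 3\<close>.\<close>
    then have "x \<noteq> 0"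
      using assms(2) by (intro notI) simp
    with x show ?thesis
      by (auto simp: nontrivial_power_of_3_def)
  qed
  have unique: "\<exists>!s. is_solution p s" if nt: "nontrivial_power_of_3 (p - 2)"
  proof -
    obtain k where k: "p - 2 = 3 ^ k"
      using nt by (auto simp: nontrivial_power_of_3_def)
    show ?thesis
    proof (rule ex1I[of _ "(k, 0, nat (p - 1))"])
      show "is_solution p (k, 0, nat (p - 1))"
        using assms(2) by (simp add: sol k)
    next
      fix s assume s: "is_solution p s"
      obtain x y z where xyz: "s = (x, y, z)"
        by (cases s)
      have "(3::int) ^ x = 3 ^ k" "y = 0" "int z = p - 1"
        using s by (auto simp: xyz sol k)
      then show "s = (k, 0, nat (p - 1))"
        by (auto simp: xyz)
    qed
  qed
  have log: "p - 2 = 3 ^ x \<longleftrightarrow> real x = log 3 (real_of_int (p - 2))" for x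
  proof -
    \<comment> \<open>Since \<open>p > 3\<close>, the argument \<open>p - 2\<close> is positive,
      where \<open>log 3\<close> really inverts \<open>powr\<close>.\<close>
    have "real x = log 3 (real_of_int (p - 2)) \<longleftrightarrow> real_of_int (p - 2) = 3 powr real x"
      using assms(2) by (auto simp: log_powr)
    also have "\<dots> \<longleftrightarrow> real_of_int (p - 2) = real_of_int (3 ^ x)"
      by (simp add: powr_realpow)
    finally show ?thesis
      by (simp only: of_int_eq_iff)
  qed
  have "\<forall>x y z. is_solution p (x, y, z) \<longleftrightarrow>
      real x = log 3 (real_of_int (p - 2)) \<and> y = 0 \<and> int z = p - 1"
    by (simp only: sol log simp_thms)
  then show ?thesis
    using power unique by blast
qed

end
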